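(* (1) Let $n\ge 1$, $0\le n_0\le n$. In the $D^*$-TASEP with $n+2$ sites, $n_0$ $0$'s and $\alpha_*=\beta_*=0$, $\alpha=\beta=1$ (restricted to configurations having $*$ at both the first and last site), the marginal process of sites $2$ through $n+1$ is isomorphic to the $\check C$-TASEP on $n$ sites with $n_0$ $0$'s. (2) Let $n\ge 2$, $0\le n_0\le n$. The $B$-TASEP with $n$ sites and $n_0$ $0$'s lumps to the marginal process of sites $2$ through $n+1$ of the $D^*$-TASEP on $n+1$ sites with $n_0$ $0$'s and $\alpha_*=0$, $\alpha=1$, $\beta=\beta_*=1/2$ (restricted to configurations having $*$ at the first site), via the map that replaces an entry $1$ or $\bar 1$ at site $n$ by $*$. (3) Let $n\ge 3$, $0\le n_0\le n$. The $D$-TASEP with $n$ sites and $n_0$ $0$'s lumps to the $D^*$-TASEP on $n$ sites with $n_0$ $0$'s and $\alpha=\alpha_*=\beta=\beta_*=1/2$, via the map that replaces an entry $1$ or $\bar 1$ at site $1$ and at site $n$ by $*$.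
   Context: Write $\bar 1=-1$. Lumping: a Markov chain on $\Omega$ lumps to a Markov chain on $\mathcal S$ via a surjection $f:\Omega\to\mathcal S$ if for all $\sigma\in\Omega$ and $s'\in\mathcal S$, $\sum_{\sigma':f(\sigma')=s'}\mathbb P(\sigma\to\sigma')=\mathbb P(f(\sigma)\to s')$. All chains below are discrete time; only changing transitions are listed, and with the remaining probability the configuration is unchanged. $\Omega_{n,n_0}$ is the set of words in $\{\bar 1,0,1\}^n$ with exactly $n_0$ $0$'s. $\check C$-TASEP on $\Omega_{n,n_0}$: each of the following has probability $\frac1{n+1}$: at the first site $\bar1\to1$; at any two neighbouring sites $1\bar1\to\bar11$, $10\to01$, $0\bar1\to\bar10$; at the last site $1\to\bar1$. $B$-TASEP on $\Omega_{n,n_0}$: first site: $\bar1\to1$ with probability $\frac1n$; sites $\ell,\ell+1$ with $1\le\ell\le n-2$: $1\bar1\to\bar11$, $10\to01$, $0\bar1\to\bar10$, each with probability $\frac1n$; last two sites: $11\to\bar1\bar1$, $1\bar1\to\bar11$, $01\to\bar10$, $0\bar1\to\bar10$, $10\to0\bar1$, $10\to01$, each with probability $\frac1{2n}$. $D$-TASEP on $\Omega_{n,n_0}$: first two sites: $\bar1\bar1\to11$, $1\bar1\to\bar11$, $\bar10\to01$, $10\to01$, $0\bar1\to10$, $0\bar1\to\bar10$, each with probability $\frac1{2(n-1)}$; sites $\ell,\ell+1$ with $2\le\ell\le n-2$: $1\bar1\to\bar11$, $10\to01$, $0\bar1\to\bar10$, each with probability $\frac1{n-1}$; last two sites: $11\to\bar1\bar1$,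 $1\bar1\to\bar11$, $01\to\bar10$, $0\bar1\to\bar10$, $10\to0\bar1$, $10\to01$, each with probability $\frac1{2(n-1)}$. $D^*$-TASEP with $N\ge 3$ sites, $n_0$ $0$'s and parameters $\alpha,\alpha_*,\beta,\beta_*\in[0,1]$: configurations are words of length $N$ with exactly $n_0$ $0$'s, sites $1$ and $N$ occupied by $0$ or $*$, and sites $2,\dots,N-1$ by $1,0,\bar1$. First two sites: $*\bar1\to*1$ with probability $\frac{\alpha}{N-1}$, $*0\to01$ with probability $\frac{\alpha_*}{N-1}$, $0\bar1\to*0$ with probability $\frac1{N-1}$. Sites $\ell,\ell+1$ with $2\le\ell\le N-2$: $1\bar1\to\bar11$, $10\to01$, $0\bar1\to\bar10$, each with probability $\frac1{N-1}$. Last two sites: $1*\to\bar1*$ with probability $\frac{\beta}{N-1}$, $0*\to\bar10$ with probability $\frac{\beta_*}{N-1}$, $10\to0*$ with probability $\frac1{N-1}$. *)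

theory Defs
  imports Complex_Main
begin


section \<open>Finite Markov chains\<close>

record 's chain =
  states :: "'s set"
  trans_prob :: "'s \<Rightarrow> 's \<Rightarrow> real"

definition markov_chain :: "'s chain \<Rightarrow> bool" where
  "markov_chain C \<longleftrightarrow>
     finite (states C) \<and> states C \<noteq> {} \<and>
     (\<forall>\<sigma>\<in>states C. \<forall>\<tau>\<in>states C. 0 \<le> trans_prob C \<sigma> \<tau>) \<and>
     (\<forall>\<sigma>\<in>states C. (\<Sum>\<tau>\<in>states C. trans_prob C \<sigma> \<tau>) = 1)"

definition lumps_via :: "('s \<Rightarrow> 't) \<Rightarrow> 's chain \<Rightarrow> 't chain \<Rightarrow> bool" where
  "lumps_via f C D \<longleftrightarrow>
     markov_chain C \<and> markov_chain D \<and> f ` states C = states D \<and>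
     (\<forall>\<sigma>\<in>states C. \<forall>s'\<in>states D.
        (\<Sum>\<sigma>'\<in>{\<sigma>'\<in>states C. f \<sigma>' = s'}. trans_prob C \<sigma> \<sigma>') = trans_prob D (f \<sigma>) s')"

definition isomorphic_chains :: "'s chain \<Rightarrow> 't chain \<Rightarrow> bool" where
  "isomorphic_chains C D \<longleftrightarrow>
     markov_chain C \<and> markov_chain D \<and>
     (\<exists>h. bij_betw h (states C) (states D) \<and>
          (\<forall>\<sigma>\<in>states C. \<forall>\<tau>\<in>states C. trans_prob D (h \<sigma>) (h \<tau>) = trans_prob C \<sigma> \<tau>))"

text \<open>The transition probabilities are kept, so the result is a \<^const>\<open>markov_chain\<close> only if
  no probability leaves \<open>A\<close>.\<close>

definition restrict_chain :: "'s chain \<Rightarrow> 's set \<Rightarrow> 's chain" where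
  "restrict_chain C A = C\<lparr>states := states C \<inter> A\<rparr>"

text \<open>The process \<open>g(X\<^sub>t)\<close> for a Markov chain \<open>X\<^sub>t\<close>. The transition probabilities are read off at an
  arbitrary preimage; the choice is immaterial, and \<open>g(X\<^sub>t)\<close> is Markov for every initial
  distribution, exactly when \<open>lumps_via g C (marginal_chain g C)\<close>.\<close>

definition marginal_chain :: "('s \<Rightarrow> 't) \<Rightarrow> 's chain \<Rightarrow> 't chain" where
  "marginal_chain g C =
     \<lparr>states = g ` states C,
      trans_prob = (\<lambda>s s'.
        \<Sum>\<sigma>'\<in>{\<sigma>'\<in>states C. g \<sigma>' = s'}. trans_prob C (SOME \<sigma>. \<sigma> \<in> states C \<and> g \<sigma> = s) \<sigma>')\<rparr>"


section \<open>Words and local moves\<close>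

text \<open>\<open>Pos\<close>, \<open>Neg\<close> stand for the letters \<open>1\<close> and \<open>-1\<close>. Sites are numbered from 1, list
  positions from 0.\<close>

datatype letter = Neg | Zero | Pos | Star

type_synonym word = "letter list"

definition sites :: "nat \<Rightarrow> nat \<Rightarrow> word \<Rightarrow> word" where
  "sites a b \<sigma> = take (b + 1 - a) (drop (a - 1) \<sigma>)"

text \<open>A move \<open>(l, u, v, p)\<close>: if the word \<open>u\<close> is read at the sites starting with \<open>l\<close>, replace it
  by \<open>v\<close> (of the same length) with probability \<open>p\<close>.\<close>

type_synonym move = "nat \<times> word \<times> word \<times> real"

definition reads :: "nat \<Rightarrow> word \<Rightarrow> word \<Rightarrow> bool" where
  "reads l u \<sigma> \<longleftrightarrow> take (length u) (drop (l - 1) \<sigma>) = u"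

definition overwrite :: "nat \<Rightarrow> word \<Rightarrow> word \<Rightarrow> word" where
  "overwrite l v \<sigma> = take (l - 1) \<sigma> @ v @ drop (l - 1 + length v) \<sigma>"

text \<open>Every move below satisfies \<open>u \<noteq> v\<close>, so the moves that apply to \<open>\<sigma>\<close> all change it.\<close>

definition chain_of :: "word set \<Rightarrow> move set \<Rightarrow> word chain" where
  "chain_of S R =
     \<lparr>states = S,
      trans_prob = (\<lambda>\<sigma> \<tau>.
        if \<tau> = \<sigma> then 1 - (\<Sum>(l, u, v, p)\<in>{(l, u, v, p)\<in>R. reads l u \<sigma>}. p)
        else (\<Sum>(l, u, v, p)\<in>{(l, u, v, p)\<in>R. reads l u \<sigma> \<and> overwrite l v \<sigma> = \<tau>}. p))\<rparr>"

definition bulk :: "nat set \<Rightarrow> real \<Rightarrow> move set" where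
  "bulk L p = (\<Union>l\<in>L.
     {(l, [Pos, Neg], [Neg, Pos], p),
      (l, [Pos, Zero], [Zero, Pos], p),
      (l, [Zero, Neg], [Neg, Zero], p)})"

text \<open>The moves at the first two sites of the D-TASEP, and at the last two sites \<open>l, l + 1\<close> of
  the B-TASEP and of the D-TASEP.\<close>

definition left_pair :: "real \<Rightarrow> move set" where
  "left_pair p =
     {(1, [Neg, Neg], [Pos, Pos], p),
      (1, [Pos, Neg], [Neg, Pos], p),
      (1, [Neg, Zero], [Zero, Pos], p),
      (1, [Pos, Zero], [Zero, Pos], p),
      (1, [Zero, Neg], [Pos, Zero], p),
      (1, [Zero, Neg], [Neg, Zero], p)}"

definition right_pair :: "nat \<Rightarrow> real \<Rightarrow> move set" where
  "right_pair l p =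
     {(l, [Pos, Pos], [Neg, Neg], p),
      (l, [Pos, Neg], [Neg, Pos], p),
      (l, [Zero, Pos], [Neg, Zero], p),
      (l, [Zero, Neg], [Neg, Zero], p),
      (l, [Pos, Zero], [Zero, Neg], p),
      (l, [Pos, Zero], [Zero, Pos], p)}"


section \<open>The TASEPs\<close>

definition Omega :: "nat \<Rightarrow> nat \<Rightarrow> word set" where
  "Omega n n0 = {\<sigma>. length \<sigma> = n \<and> set \<sigma> \<subseteq> {Neg, Zero, Pos} \<and> count_list \<sigma> Zero = n0}"

definition C_check_TASEP :: "nat \<Rightarrow> nat \<Rightarrow> word chain" where
  "C_check_TASEP n n0 =
     (let p = 1 / (real n + 1) in
      chain_of (Omega n n0)
        ({(1, [Neg], [Pos], p)} \<union> bulk {1..n - 1} p \<union> {(n, [Pos], [Neg], p)}))"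

definition B_TASEP :: "nat \<Rightarrow> nat \<Rightarrow> word chain" where
  "B_TASEP n n0 =
     (let p = 1 / real n in
      chain_of (Omega n n0)
        ({(1, [Neg], [Pos], p)} \<union> bulk {1..n - 2} p \<union> right_pair (n - 1) (p / 2)))"

definition D_TASEP :: "nat \<Rightarrow> nat \<Rightarrow> word chain" where
  "D_TASEP n n0 =
     (let p = 1 / (real n - 1) in
      chain_of (Omega n n0)
        (left_pair (p / 2) \<union> bulk {2..n - 2} p \<union> right_pair (n - 1) (p / 2)))"

definition Omega_star :: "nat \<Rightarrow> nat \<Rightarrow> word set" where
  "Omega_star N n0 =
     {\<sigma>. length \<sigma> = N \<and> hd \<sigma> \<in> {Zero, Star} \<and> last \<sigma> \<in> {Zero, Star} \<and>
         set (sites 2 (N - 1) \<sigma>) \<subseteq> {Neg, Zero, Pos} \<and> count_list \<sigma> Zero = n0}"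

text \<open>The parameters \<open>a\<close>, \<open>a'\<close>, \<open>b\<close>, \<open>b'\<close> are \<open>\<alpha>\<close>, \<open>\<alpha>\<^sub>*\<close>, \<open>\<beta>\<close>, \<open>\<beta>\<^sub>*\<close>.\<close>

definition D_star_TASEP ::
  "nat \<Rightarrow> nat \<Rightarrow> real \<Rightarrow> real \<Rightarrow> real \<Rightarrow> real \<Rightarrow> word chain" where
  "D_star_TASEP N n0 a a' b b' =
     (let p = 1 / (real N - 1) in
      chain_of (Omega_star N n0)
        ({(1, [Star, Neg], [Star, Pos], a * p),
          (1, [Star, Zero], [Zero, Pos], a' * p),
          (1, [Zero, Neg], [Star, Zero], p)} \<union>
         bulk {2..N - 2} p \<union>
         {(N - 1, [Pos, Star], [Neg, Star], b * p),
          (N - 1, [Zero, Star], [Neg, Zero], b' * p),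
          (N - 1, [Pos, Zero], [Zero, Star], p)}))"

definition star_at :: "nat \<Rightarrow> word \<Rightarrow> word" where
  "star_at l \<sigma> = (if \<sigma> ! (l - 1) \<in> {Neg, Pos} then \<sigma>[l - 1 := Star] else \<sigma>)"

end

theory Submission
  imports Defs
begin

text \<open>For a set \<open>R\<close> of local moves and a function \<open>\<phi>\<close> on words, let \<open>move_sum R \<phi> \<sigma>\<close> be the sum of
  \<open>p * \<phi> \<sigma>'\<close> over the moves \<open>\<sigma> \<rightarrow> \<sigma>'\<close> of probability \<open>p\<close> that apply to \<open>\<sigma>\<close>. The expected value of
  \<open>\<phi>\<close> after one step of the chain is \<open>\<phi> \<sigma>\<close> plus the move sum of \<open>\<phi> - \<phi> \<sigma>\<close>
  (\<open>expectation_after_step\<close>). Hence a map \<open>f\<close> lumps the chain with moves \<open>R\<close> to the chain with moves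
  \<open>R'\<close> as soon as \<open>move_sum R' \<phi> (f \<sigma>) = move_sum R (\<phi> \<circ> f) \<sigma>\<close> for all \<open>\<phi>\<close>
  (\<open>lumps_via_if_intertwines\<close>). In contrast to the defining equation of a lumping, this condition is
  additive in the moves, so it can be checked separately at the left end, at each bulk bond, and at
  the right end.

  In each of the three parts, \<open>f\<close> alters a word only at its ends: it attaches a star, or replaces
  a nonzero end letter by a star. The bulk bonds do not meet the replaced letters, so the bulk moves
  correspond one to one, up to a shift of the sites (\<open>bulk_intertwines\<close>). At an end with parameters \<open>1\<close>
  and \<open>0\<close> the attached star is a permanent reservoir, and the boundary moves again correspond
  one to one. At an end with parameters \<open>1/2\<close> the star stands for a letter \<open>1\<close> or \<open>-1\<close> whose sign has been
  forgotten. Whether a move applies there does not depend on that sign; if so, it has half of the bulk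
  probability for either sign, and the two outcomes agree once their signs are forgotten. When
  the end letter is \<open>0\<close>, the exchange with its neighbour is split into two moves of half the bulk
  probability whose outcomes differ only in the sign placed at the end; they merge into one move of
  full probability.

  This gives lumpings from the words without stars onto the chains with stars. Deleting the stars at
  the fixed ends is injective, so the marginal process is a relabelling, and composing
  the two maps gives the theorem; in the first part the composition is the identity, whence the
  isomorphism.\<close>


section \<open>Lumping and marginals of finite chains\<close>

text \<open>The target is a Markov chain automatically: its transition probabilities are sums of those of \<open>C\<close>,
  and the fibres of \<open>f\<close> partition the states, so its rows also sum to \<open>1\<close>.\<close>

lemma lumps_viaI:
  assumes C: "markov_chain C" and img: "f ` states C = states D"
    and eq: "\<And>\<sigma> s'. \<sigma> \<in> states C \<Longrightarrow> s' \<in> states D \<Longrightarrow>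
      (\<Sum>\<sigma>'\<in>{\<sigma>'\<in>states C. f \<sigma>' = s'}. trans_prob C \<sigma> \<sigma>') = trans_prob D (f \<sigma>) s'"
  shows "lumps_via f C D"
proof -
  have fin: "finite (states C)" using C by (simp add: markov_chain_def)
  have nonneg: "0 \<le> trans_prob D s t" if s: "s \<in> states D" and t: "t \<in> states D" for s t
  proof -
    obtain \<sigma> where \<sigma>: "\<sigma> \<in> states C" "s = f \<sigma>" using s img by blast
    show ?thesis using C \<sigma> by (auto simp: eq[OF \<sigma>(1) t, symmetric] markov_chain_def intro!: sum_nonneg)
  qed
  have one: "(\<Sum>t\<in>states D. trans_prob D s t) = 1" if s: "s \<in> states D" for s
  proof -
    obtain \<sigma> where \<sigma>: "\<sigma> \<in> states C" "s = f \<sigma>" using s img by blast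
    have "(\<Sum>t\<in>states D. trans_prob D s t)
        = (\<Sum>t\<in>f ` states C. \<Sum>\<sigma>'\<in>{\<sigma>'\<in>states C. f \<sigma>' = t}. trans_prob C \<sigma> \<sigma>')"
      unfolding img \<sigma>(2) by (rule sum.cong) (simp_all add: eq[OF \<sigma>(1)])
    also have "\<dots> = (\<Sum>\<sigma>'\<in>states C. trans_prob C \<sigma> \<sigma>')"
      by (rule sum.image_gen[OF fin, symmetric])
    finally show ?thesis using C \<sigma> by (simp add: markov_chain_def)
  qed
  have "finite (states D)" "states D \<noteq> {}"
    using C img by (auto simp: markov_chain_def simp flip: img)
  then have "markov_chain D" using nonneg one by (simp add: markov_chain_def)
  then show ?thesis using C img eq by (simp add: lumps_via_def)
qed

lemma lumps_via_comp:
  assumes CD: "lumps_via f C D" and DE: "lumps_via g D E"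
  shows "lumps_via (g \<circ> f) C E"
proof (rule lumps_viaI)
  show C: "markov_chain C" using CD by (simp add: lumps_via_def)
  have fD: "f ` states C = states D" and gE: "g ` states D = states E"
    using CD DE by (simp_all add: lumps_via_def)
  then show "(g \<circ> f) ` states C = states E" by (simp only: image_comp[symmetric])
  fix \<sigma> e assume \<sigma>: "\<sigma> \<in> states C" and e: "e \<in> states E"
  let ?A = "{\<sigma>'\<in>states C. (g \<circ> f) \<sigma>' = e}"
  have fin: "finite ?A" using C by (simp add: markov_chain_def)
  have fA: "f ` ?A = {t\<in>states D. g t = e}" using fD by auto
  have "(\<Sum>\<sigma>'\<in>?A. trans_prob C \<sigma> \<sigma>')
      = (\<Sum>t\<in>f ` ?A. \<Sum>\<sigma>'\<in>{\<sigma>'\<in>?A. f \<sigma>' = t}. trans_prob C \<sigma> \<sigma>')"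
    by (rule sum.image_gen[OF fin])
  also have "\<dots> = (\<Sum>t\<in>{t\<in>states D. g t = e}. trans_prob D (f \<sigma>) t)"
    unfolding fA
  proof (rule sum.cong[OF refl])
    fix t assume t: "t \<in> {t\<in>states D. g t = e}"
    then have "{\<sigma>'\<in>?A. f \<sigma>' = t} = {\<sigma>'\<in>states C. f \<sigma>' = t}" by auto
    then show "(\<Sum>\<sigma>'\<in>{\<sigma>'\<in>?A. f \<sigma>' = t}. trans_prob C \<sigma> \<sigma>') = trans_prob D (f \<sigma>) t"
      using CD \<sigma> t by (simp add: lumps_via_def)
  qed
  also have "\<dots> = trans_prob E (g (f \<sigma>)) e"
    using DE \<sigma> e fD by (auto simp: lumps_via_def)
  finally show "(\<Sum>\<sigma>'\<in>?A. trans_prob C \<sigma> \<sigma>') = trans_prob E ((g \<circ> f) \<sigma>) e" by simp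
qed

lemma lumps_via_cong:
  assumes "lumps_via f C D" and fg: "\<And>\<sigma>. \<sigma> \<in> states C \<Longrightarrow> f \<sigma> = g \<sigma>"
  shows "lumps_via g C D"
proof -
  have "{\<sigma>'\<in>states C. g \<sigma>' = s} = {\<sigma>'\<in>states C. f \<sigma>' = s}" for s using fg by auto
  moreover have "g ` states C = f ` states C" using fg by (auto intro!: image_cong)
  ultimately show ?thesis using assms by (simp add: lumps_via_def)
qed

text \<open>By injectivity, the preimage at which the marginal chain reads off its transition
  probabilities is the given state.\<close>

lemma lumps_via_marginal:
  assumes C: "markov_chain C" and inj: "inj_on g (states C)"
  shows "lumps_via g C (marginal_chain g C)"
proof (rule lumps_viaI[OF C])
  show "g ` states C = states (marginal_chain g C)" by (simp add: marginal_chain_def)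
  fix \<sigma> s' assume \<sigma>: "\<sigma> \<in> states C" and "s' \<in> states (marginal_chain g C)"
  have "(SOME \<rho>. \<rho> \<in> states C \<and> g \<rho> = g \<sigma>) = \<sigma>"
    using inj \<sigma> by (intro some_equality) (auto dest: inj_onD)
  then show "(\<Sum>\<sigma>'\<in>{\<sigma>'\<in>states C. g \<sigma>' = s'}. trans_prob C \<sigma> \<sigma>')
      = trans_prob (marginal_chain g C) (g \<sigma>) s'"
    by (simp add: marginal_chain_def)
qed

lemma isomorphic_chains_if_lumps_via_id:
  assumes "lumps_via (\<lambda>\<sigma>. \<sigma>) C D"
  shows "isomorphic_chains D C"
proof -
  have st: "states C = states D" using assms by (simp add: lumps_via_def)
  have "trans_prob C \<sigma> \<tau> = trans_prob D \<sigma> \<tau>" if "\<sigma> \<in> states D" "\<tau> \<in> states D" for \<sigma> \<tau>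
  proof -
    have "{\<sigma>'\<in>states C. \<sigma>' = \<tau>} = {\<tau>}" using that st by auto
    moreover have "(\<Sum>\<sigma>'\<in>{\<sigma>'\<in>states C. \<sigma>' = \<tau>}. trans_prob C \<sigma> \<sigma>') = trans_prob D \<sigma> \<tau>"
      using assms that st by (simp add: lumps_via_def)
    ultimately show ?thesis by simp
  qed
  then show ?thesis using assms st unfolding isomorphic_chains_def
    by (auto simp: lumps_via_def intro!: exI[of _ "\<lambda>x. x"] bij_betwI')
qed


section \<open>Chains given by local moves\<close>

text \<open>Up to the term that accounts for staying put, this is the generator of the chain; its
  additivity in \<open>R\<close> is what makes local comparisons possible.\<close>

definition move_sum :: "move set \<Rightarrow> (word \<Rightarrow> real) \<Rightarrow> word \<Rightarrow> real" where
  "move_sum R \<phi> \<sigma> = (\<Sum>(l, u, v, p)\<in>R. if reads l u \<sigma> then p * \<phi> (overwrite l v \<sigma>) else 0)"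

definition proper_moves :: "move set \<Rightarrow> bool" where
  "proper_moves R \<longleftrightarrow> finite R \<and> (\<forall>(l, u, v, p)\<in>R. length v = length u \<and> v \<noteq> u)"

lemma reads_decomp:
  assumes "reads l u \<sigma>"
  shows "\<sigma> = take (l - 1) \<sigma> @ u @ drop (l - 1 + length u) \<sigma>"
  using assms unfolding reads_def
  by (metis append_take_drop_id drop_drop add.commute)

lemma overwrite_neq:
  assumes "proper_moves R" "(l, u, v, p) \<in> R" "reads l u \<sigma>"
  shows "overwrite l v \<sigma> \<noteq> \<sigma>"
proof
  assume eq: "overwrite l v \<sigma> = \<sigma>"
  have len: "length v = length u" and "v \<noteq> u" using assms by (auto simp: proper_moves_def)
  have "take (l - 1) \<sigma> @ v @ drop (l - 1 + length u) \<sigma> = take (l - 1) \<sigma> @ u @ drop (l - 1 + length u) \<sigma>"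
    using eq reads_decomp[OF assms(3)] len by (simp add: overwrite_def)
  then show False using \<open>v \<noteq> u\<close> by simp
qed

text \<open>Since no applicable move fixes \<open>\<sigma>\<close>, both branches of the definition have this form: off the diagonal the
  subtracted term vanishes, and on the diagonal every applicable move contributes \<open>-p\<close>.\<close>

lemma trans_prob_chain_of:
  assumes R: "proper_moves R"
  shows "trans_prob (chain_of S R) \<sigma> \<tau>
    = of_bool (\<sigma> = \<tau>) + move_sum R (\<lambda>\<rho>. of_bool (\<rho> = \<tau>) - of_bool (\<sigma> = \<tau>)) \<sigma>"
proof -
  have fin: "finite R" using R by (simp add: proper_moves_def)
  show ?thesis
  proof (cases "\<tau> = \<sigma>")
    case True
    have "(\<Sum>(l, u, v, p)\<in>{(l, u, v, p)\<in>R. reads l u \<sigma>}. p)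
        = (\<Sum>m\<in>R. case m of (l, u, v, p) \<Rightarrow> if reads l u \<sigma> then p else 0)"
      by (rule sum.mono_neutral_cong_left) (use fin in \<open>auto split: if_splits\<close>)
    also have "\<dots> = - move_sum R (\<lambda>\<rho>. of_bool (\<rho> = \<tau>) - of_bool (\<sigma> = \<tau>)) \<sigma>"
      unfolding move_sum_def sum_negf[symmetric]
      by (rule sum.cong) (use True overwrite_neq[OF R] in auto)
    finally show ?thesis using True by (simp add: chain_of_def)
  next
    case False
    have "(\<Sum>(l, u, v, p)\<in>{(l, u, v, p)\<in>R. reads l u \<sigma> \<and> overwrite l v \<sigma> = \<tau>}. p)
        = move_sum R (\<lambda>\<rho>. of_bool (\<rho> = \<tau>) - of_bool (\<sigma> = \<tau>)) \<sigma>"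
      unfolding move_sum_def
      by (rule sum.mono_neutral_cong_left) (use fin False in \<open>auto split: if_splits\<close>)
    then show ?thesis using False by (simp add: chain_of_def)
  qed
qed

lemma states_chain_of [simp]: "states (chain_of S R) = S"
  by (simp add: chain_of_def)

text \<open>This turns sums over target states into sums over moves. With \<open>\<phi> = 1\<close> it shows that rows sum to
  \<open>1\<close>, and with \<open>\<phi>\<close> the indicator of a fibre it computes the left side of a lumping equation.\<close>

lemma expectation_after_step:
  assumes R: "proper_moves R" and S: "finite S" "\<sigma> \<in> S"
    and closed: "\<And>l u v p. (l, u, v, p) \<in> R \<Longrightarrow> reads l u \<sigma> \<Longrightarrow> overwrite l v \<sigma> \<in> S"
  shows "(\<Sum>\<tau>\<in>S. trans_prob (chain_of S R) \<sigma> \<tau> * \<phi> \<tau>)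
    = \<phi> \<sigma> + move_sum R (\<lambda>\<rho>. \<phi> \<rho> - \<phi> \<sigma>) \<sigma>"
proof -
  have pick: "(\<Sum>\<tau>\<in>S. of_bool (\<rho> = \<tau>) * \<phi> \<tau>) = \<phi> \<rho>" if "\<rho> \<in> S" for \<rho>
    using S that by (simp add: of_bool_def if_distrib[of "\<lambda>x. x * _"] cong: if_cong)
  have "(\<Sum>\<tau>\<in>S. move_sum R (\<lambda>\<rho>. of_bool (\<rho> = \<tau>) - of_bool (\<sigma> = \<tau>)) \<sigma> * \<phi> \<tau>)
      = (\<Sum>m\<in>R. \<Sum>\<tau>\<in>S. (case m of (l, u, v, p) \<Rightarrow>
          if reads l u \<sigma> then p * (of_bool (overwrite l v \<sigma> = \<tau>) - of_bool (\<sigma> = \<tau>)) else 0) * \<phi> \<tau>)"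
    unfolding move_sum_def sum_distrib_right by (rule sum.swap)
  also have "\<dots> = move_sum R (\<lambda>\<rho>. \<phi> \<rho> - \<phi> \<sigma>) \<sigma>"
    unfolding move_sum_def
  proof (rule sum.cong[OF refl], clarify)
    fix l u v p assume m: "(l, u, v, p) \<in> R"
    show "(\<Sum>\<tau>\<in>S. (if reads l u \<sigma> then p * (of_bool (overwrite l v \<sigma> = \<tau>) - of_bool (\<sigma> = \<tau>)) else 0) * \<phi> \<tau>)
        = (if reads l u \<sigma> then p * (\<phi> (overwrite l v \<sigma>) - \<phi> \<sigma>) else 0)"
    proof (cases "reads l u \<sigma>")
      case True
      have "(\<Sum>\<tau>\<in>S. p * (of_bool (overwrite l v \<sigma> = \<tau>) - of_bool (\<sigma> = \<tau>)) * \<phi> \<tau>)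
          = p * ((\<Sum>\<tau>\<in>S. of_bool (overwrite l v \<sigma> = \<tau>) * \<phi> \<tau>) - (\<Sum>\<tau>\<in>S. of_bool (\<sigma> = \<tau>) * \<phi> \<tau>))"
        by (simp only: sum_subtractf[symmetric] sum_distrib_left left_diff_distrib mult.assoc)
      then show ?thesis using True closed[OF m True] S by (simp add: pick)
    qed simp
  qed
  finally show ?thesis
    using S by (simp add: trans_prob_chain_of[OF R] distrib_right sum.distrib pick)
qed

lemma markov_chain_chain_of:
  assumes R: "proper_moves R" and S: "finite S" "S \<noteq> {}"
    and closed: "\<And>l u v p \<sigma>. \<sigma> \<in> S \<Longrightarrow> (l, u, v, p) \<in> R \<Longrightarrow> reads l u \<sigma> \<Longrightarrow> overwrite l v \<sigma> \<in> S"
    and nonneg: "\<And>l u v p. (l, u, v, p) \<in> R \<Longrightarrow> 0 \<le> p"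
    and le1: "\<And>\<sigma>. \<sigma> \<in> S \<Longrightarrow> move_sum R (\<lambda>_. 1) \<sigma> \<le> 1"
  shows "markov_chain (chain_of S R)"
  unfolding markov_chain_def states_chain_of
proof (intro conjI ballI)
  fix \<sigma> \<tau> assume \<sigma>: "\<sigma> \<in> S"
  show "(\<Sum>\<tau>\<in>S. trans_prob (chain_of S R) \<sigma> \<tau>) = 1"
    using expectation_after_step[OF R S(1) \<sigma>, where \<phi> = "\<lambda>_. 1"] closed[OF \<sigma>]
    by (simp add: move_sum_def split_beta cong: if_cong)
  show "0 \<le> trans_prob (chain_of S R) \<sigma> \<tau>"
  proof (cases "\<sigma> = \<tau>")
    case True
    have "- move_sum R (\<lambda>_. 1) \<sigma> \<le> move_sum R (\<lambda>\<rho>. of_bool (\<rho> = \<tau>) - of_bool (\<sigma> = \<tau>)) \<sigma>"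
      unfolding move_sum_def sum_negf[symmetric]
      by (rule sum_mono) (use nonneg True in auto)
    then show ?thesis using le1[OF \<sigma>] True by (simp add: trans_prob_chain_of[OF R])
  next
    case False
    then show ?thesis unfolding trans_prob_chain_of[OF R] move_sum_def
      using nonneg by (auto intro!: sum_nonneg)
  qed
qed (use S in auto)

text \<open>Apply \<open>expectation_after_step\<close> to the indicator of the fibre over \<open>s'\<close> and rewrite the move sum by the
  assumption; the result is the formula for the transition probability of the target.\<close>

lemma lumps_via_if_intertwines:
  assumes C: "markov_chain (chain_of S R)" and R: "proper_moves R" and R': "proper_moves R'"
    and closed: "\<And>l u v p \<sigma>. \<sigma> \<in> S \<Longrightarrow> (l, u, v, p) \<in> R \<Longrightarrow> reads l u \<sigma> \<Longrightarrow> overwrite l v \<sigma> \<in> S"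
    and img: "f ` S = S'"
    and intertwines: "\<And>\<sigma> \<phi>. \<sigma> \<in> S \<Longrightarrow> move_sum R' \<phi> (f \<sigma>) = move_sum R (\<phi> \<circ> f) \<sigma>"
  shows "lumps_via f (chain_of S R) (chain_of S' R')"
proof (rule lumps_viaI[OF C])
  show "f ` states (chain_of S R) = states (chain_of S' R')" using img by simp
  fix \<sigma> s' assume "\<sigma> \<in> states (chain_of S R)"
  then have \<sigma>: "\<sigma> \<in> S" by simp
  have fin: "finite S" using C by (simp add: markov_chain_def)
  have "(\<Sum>\<sigma>'\<in>{\<sigma>'\<in>states (chain_of S R). f \<sigma>' = s'}. trans_prob (chain_of S R) \<sigma> \<sigma>')
      = (\<Sum>\<tau>\<in>S. trans_prob (chain_of S R) \<sigma> \<tau> * of_bool (f \<tau> = s'))"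
    by (rule sum.mono_neutral_cong_left) (use fin in auto)
  also have "\<dots> = of_bool (f \<sigma> = s')
      + move_sum R ((\<lambda>\<rho>. of_bool (\<rho> = s') - of_bool (f \<sigma> = s')) \<circ> f) \<sigma>"
    using expectation_after_step[OF R fin \<sigma> closed[OF \<sigma>], where \<phi> = "\<lambda>\<tau>. of_bool (f \<tau> = s')"]
    by (simp add: comp_def)
  also have "\<dots> = trans_prob (chain_of S' R') (f \<sigma>) s'"
    by (simp add: trans_prob_chain_of[OF R'] intertwines[OF \<sigma>])
  finally show "(\<Sum>\<sigma>'\<in>{\<sigma>'\<in>states (chain_of S R). f \<sigma>' = s'}. trans_prob (chain_of S R) \<sigma> \<sigma>')
      = trans_prob (chain_of S' R') (f \<sigma>) s'" .
qed

lemma move_sum_Un: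
  "finite A \<Longrightarrow> finite B \<Longrightarrow> A \<inter> B = {} \<Longrightarrow> move_sum (A \<union> B) \<phi> \<sigma> = move_sum A \<phi> \<sigma> + move_sum B \<phi> \<sigma>"
  by (simp add: move_sum_def sum.union_disjoint)

lemma move_sum_bulk:
  assumes "finite L"
  shows "move_sum (bulk L p) \<phi> \<sigma> = (\<Sum>l\<in>L. move_sum (bulk {l} p) \<phi> \<sigma>)"
proof -
  have "bulk L p = (\<Union>l\<in>L. bulk {l} p)" by (simp add: bulk_def)
  then show ?thesis unfolding move_sum_def
    by (simp only:) (rule sum.UNION_disjoint, use assms in \<open>auto simp: bulk_def\<close>)
qed

lemma finite_bulk: "finite L \<Longrightarrow> finite (bulk L p)"
  by (simp add: bulk_def)

lemma proper_moves_bulk: "finite L \<Longrightarrow> proper_moves (bulk L p)"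
  by (auto simp: proper_moves_def bulk_def)

lemma proper_moves_Un: "proper_moves A \<Longrightarrow> proper_moves B \<Longrightarrow> proper_moves (A \<union> B)"
  by (auto simp: proper_moves_def)

text \<open>If \<open>f\<close> transports the letters at a bond unchanged to the bond shifted by \<open>d\<close>, and what it does to
  the other sites does not depend on these letters, then reading and overwriting the bond commute
  with \<open>f\<close>.\<close>

lemma bulk_intertwines:
  assumes L: "finite L"
    and local: "\<And>l. l \<in> L \<Longrightarrow> \<exists>r a b t r' t'. \<sigma> = r @ [a, b] @ t \<and> length r = l - 1 \<and>
      length r' = l + d - 1 \<and> (\<forall>c e. f (r @ [c, e] @ t) = r' @ [c, e] @ t')"
  shows "move_sum (bulk ((\<lambda>l. l + d) ` L) p) \<phi> (f \<sigma>) = move_sum (bulk L p) (\<phi> \<circ> f) \<sigma>"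
proof -
  have *: "move_sum (bulk {l + d} p) \<phi> (f \<sigma>) = move_sum (bulk {l} p) (\<phi> \<circ> f) \<sigma>" if l: "l \<in> L" for l
  proof -
    obtain r a b t r' t' where \<sigma>: "\<sigma> = r @ [a, b] @ t" and r: "length r = l - 1"
      and r': "length r' = l + d - 1" and f: "\<And>c e. f (r @ [c, e] @ t) = r' @ [c, e] @ t'"
      using local[OF l] by blast
    show ?thesis unfolding \<sigma> f
      using f r r' by (simp add: move_sum_def bulk_def reads_def overwrite_def)
  qed
  show ?thesis
    using L * by (simp add: move_sum_bulk[of "(\<lambda>l. l + d) ` L"] move_sum_bulk[of L] sum.reindex)
qed

lemma obtain_pair:
  assumes "1 \<le> l" "l < length \<sigma>"
  obtains r a b t where "\<sigma> = r @ [a, b] @ t" "length r = l - 1"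
proof
  show "\<sigma> = take (l - 1) \<sigma> @ [\<sigma> ! (l - 1), \<sigma> ! l] @ drop (l + 1) \<sigma>"
    using assms id_take_nth_drop[of "l - 1" \<sigma>] Cons_nth_drop_Suc[of l \<sigma>] by simp
qed (use assms in simp)


section \<open>Boundary moves\<close>

text \<open>The effect of \<^const>\<open>star_at\<close> on the letter at the chosen site.\<close>

definition star :: "letter \<Rightarrow> letter" where
  "star x = (if x \<in> {Neg, Pos} then Star else x)"

lemma star_at_append: "length r = l - 1 \<Longrightarrow> star_at l (r @ x # t) = r @ star x # t"
  by (simp add: star_at_def star_def nth_append list_update_append)

definition star_left :: "real \<Rightarrow> real \<Rightarrow> real \<Rightarrow> move set" where
  "star_left a a' p =
     {(1, [Star, Neg], [Star, Pos], a * p),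
      (1, [Star, Zero], [Zero, Pos], a' * p),
      (1, [Zero, Neg], [Star, Zero], p)}"

definition star_right :: "nat \<Rightarrow> real \<Rightarrow> real \<Rightarrow> real \<Rightarrow> move set" where
  "star_right l b b' p =
     {(l, [Pos, Star], [Neg, Star], b * p),
      (l, [Zero, Star], [Neg, Zero], b' * p),
      (l, [Pos, Zero], [Zero, Star], p)}"

lemmas boundary_defs = left_pair_def right_pair_def star_left_def star_right_def

text \<open>With a star permanently attached on the left, only the first of the three moves matters: the
  second has probability \<open>0\<close>, and the third requires a \<open>0\<close> at the first site.\<close>

lemma left_site_intertwines:
  assumes f: "\<And>x. f (x # t) = Star # x # t'"
  shows "move_sum (star_left 1 0 p) \<phi> (f (x # t)) = move_sum {(1, [Neg], [Pos], p)} (\<phi> \<circ> f) (x # t)"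
  by (simp add: f move_sum_def star_left_def reads_def overwrite_def)

text \<open>A starred first site comes from \<open>1\<close> or \<open>-1\<close>, and for either sign the same starred outcome is
  reached with half the bulk probability. From \<open>0\<close> followed by \<open>-1\<close>, the two moves of half the bulk
  probability produce words that differ in the sign of the first letter only, and so merge.\<close>

lemma left_pair_intertwines:
  assumes f: "\<And>x y. f (x # y # t) = star x # y # t'" and "x \<noteq> Star" "y \<noteq> Star"
  shows "move_sum (star_left (1/2) (1/2) p) \<phi> (f (x # y # t))
    = move_sum (left_pair (p / 2)) (\<phi> \<circ> f) (x # y # t)"
  using assms(2,3)
  by (cases x; cases y) (simp_all add: f move_sum_def boundary_defs star_def reads_def overwrite_def)

text \<open>The mirror images of the two comparisons at the left end.\<close>

lemma right_site_intertwines: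
  assumes f: "\<And>x. f (r @ [x]) = r' @ [x, Star]" and r: "length r = l - 1" "length r' = l' - 1"
  shows "move_sum (star_right l' 1 0 p) \<phi> (f (r @ [x])) = move_sum {(l, [Pos], [Neg], p)} (\<phi> \<circ> f) (r @ [x])"
  using r by (simp add: f move_sum_def star_right_def reads_def overwrite_def)

lemma right_pair_intertwines:
  assumes f: "\<And>x y. f (r @ [x, y]) = r' @ [x, star y]" and r: "length r = l - 1" "length r' = l' - 1"
    and "x \<noteq> Star" "y \<noteq> Star"
  shows "move_sum (star_right l' (1/2) (1/2) p) \<phi> (f (r @ [x, y]))
    = move_sum (right_pair l (p / 2)) (\<phi> \<circ> f) (r @ [x, y])"
  using assms(4,5) r
  by (cases x; cases y) (simp_all add: f move_sum_def boundary_defs star_def reads_def overwrite_def)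

lemma proper_moves_boundary:
  "proper_moves (star_left a a' p)" "proper_moves (star_right l b b' p)"
  by (simp_all add: proper_moves_def boundary_defs)

lemma D_star_TASEP_eq:
  assumes "p = 1 / (real N - 1)"
  shows "D_star_TASEP N n0 a a' b b' = chain_of (Omega_star N n0)
    (star_left a a' p \<union> bulk {2..N - 2} p \<union> star_right (N - 1) b b' p)"
  using assms by (simp add: D_star_TASEP_def star_left_def star_right_def Let_def)

lemma move_sum_D_star:
  assumes "3 \<le> N"
  shows "move_sum (star_left a a' p \<union> bulk {2..N - 2} p \<union> star_right (N - 1) b b' p) \<phi> \<sigma>
    = move_sum (star_left a a' p) \<phi> \<sigma> + move_sum (bulk {2..N - 2} p) \<phi> \<sigma>
      + move_sum (star_right (N - 1) b b' p) \<phi> \<sigma>"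
proof -
  have "finite (star_left a a' p)" "finite (star_right (N - 1) b b' p)"
    "star_left a a' p \<inter> bulk {2..N - 2} p = {}"
    "(star_left a a' p \<union> bulk {2..N - 2} p) \<inter> star_right (N - 1) b b' p = {}"
    using assms by (auto simp: boundary_defs bulk_def)
  then show ?thesis by (simp add: move_sum_Un finite_bulk)
qed

lemma proper_moves_D_star:
  "proper_moves (star_left a a' p \<union> bulk {2..N - 2} p \<union> star_right (N - 1) b b' p)"
  by (intro proper_moves_Un proper_moves_boundary proper_moves_bulk) simp


section \<open>Chains on words without a star\<close>

text \<open>The conditions on single moves under which every set \<^term>\<open>Omega n n0\<close> is invariant and
  all off-diagonal transition probabilities are nonnegative.\<close>

definition Omega_moves :: "move set \<Rightarrow> bool" where
  "Omega_moves R \<longleftrightarrow> proper_moves R \<and>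
     (\<forall>(l, u, v, p)\<in>R. set v \<subseteq> {Neg, Zero, Pos} \<and> count_list v Zero = count_list u Zero \<and> 0 \<le> p)"

lemma Omega_moves_Un: "Omega_moves A \<Longrightarrow> Omega_moves B \<Longrightarrow> Omega_moves (A \<union> B)"
  by (auto simp: Omega_moves_def proper_moves_def)

lemma Omega_moves_TASEP:
  assumes "0 \<le> p"
  shows "Omega_moves {(1, [Neg], [Pos], p)}" "Omega_moves {(l, [Pos], [Neg], p)}"
    "Omega_moves (left_pair (p / 2))" "Omega_moves (right_pair l (p / 2))"
    "finite L \<Longrightarrow> Omega_moves (bulk L p)"
  using assms by (auto simp: Omega_moves_def proper_moves_def boundary_defs bulk_def)

lemma overwrite_in_Omega:
  assumes R: "Omega_moves R" and \<sigma>: "\<sigma> \<in> Omega n n0"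
    and m: "(l, u, v, p) \<in> R" "reads l u \<sigma>"
  shows "overwrite l v \<sigma> \<in> Omega n n0"
proof -
  have v: "length v = length u" "set v \<subseteq> {Neg, Zero, Pos}" "count_list v Zero = count_list u Zero"
    using R m(1) by (auto simp: proper_moves_def Omega_moves_def)
  define r t where "r = take (l - 1) \<sigma>" and "t = drop (l - 1 + length u) \<sigma>"
  have "\<sigma> = r @ u @ t" using reads_decomp[OF m(2)] by (simp add: r_def t_def)
  moreover have "overwrite l v \<sigma> = r @ v @ t" using v by (simp add: overwrite_def r_def t_def)
  ultimately show ?thesis using \<sigma> v by (simp add: Omega_def)
qed

lemma count_list_replicate: "count_list (replicate k x) y = (if x = y then k else 0)"
  by (induction k) auto

lemma finite_Omega: "finite (Omega n n0)"
proof -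
  have "Omega n n0 \<subseteq> {xs. set xs \<subseteq> {Neg, Zero, Pos} \<and> length xs = n}"
    by (auto simp: Omega_def)
  then show ?thesis using finite_lists_length_eq[of "{Neg, Zero, Pos}" n]
    by (auto intro: finite_subset)
qed

lemma Omega_nonempty: "n0 \<le> n \<Longrightarrow> Omega n n0 \<noteq> {}"
proof -
  assume "n0 \<le> n"
  then have "replicate n0 Zero @ replicate (n - n0) Pos \<in> Omega n n0"
    by (auto simp: Omega_def count_list_replicate)
  then show ?thesis by blast
qed

text \<open>The three moves at a bond read different pairs of letters, so at most one of them applies.\<close>

lemma exit_bulk_le:
  assumes "0 \<le> p" "finite L"
  shows "move_sum (bulk L p) (\<lambda>_. 1) \<sigma> \<le> real (card L) * p"
proof -
  have "move_sum (bulk {l} p) (\<lambda>_. 1) \<sigma> \<le> p" for l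
    using assms(1) by (simp add: move_sum_def bulk_def reads_def)
  then show ?thesis
    unfolding move_sum_bulk[OF assms(2)] by (intro sum_bounded_above)
qed

text \<open>At most two moves of a boundary pair apply to a given word, which is why each has half the bulk probability.\<close>

lemma exit_boundary_le:
  assumes "0 \<le> p"
  shows "move_sum {(l, u, v, p)} (\<lambda>_. 1) \<sigma> \<le> p"
    "move_sum (left_pair (p / 2)) (\<lambda>_. 1) \<sigma> \<le> p"
    "move_sum (right_pair l (p / 2)) (\<lambda>_. 1) \<sigma> \<le> p"
  using assms by (simp_all add: move_sum_def boundary_defs reads_def)

lemma markov_chain_Omega:
  assumes "n0 \<le> n" and R: "Omega_moves R"
    and le1: "\<And>\<sigma>. \<sigma> \<in> Omega n n0 \<Longrightarrow> move_sum R (\<lambda>_. 1) \<sigma> \<le> 1"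
  shows "markov_chain (chain_of (Omega n n0) R)"
proof (rule markov_chain_chain_of)
  show "proper_moves R" and "\<And>l u v p. (l, u, v, p) \<in> R \<Longrightarrow> 0 \<le> p"
    using R by (auto simp: Omega_moves_def)
qed (use assms in \<open>auto intro: overwrite_in_Omega finite_Omega simp: Omega_nonempty\<close>)

text \<open>The argument common to the three chains. Each has \<open>card L + 2\<close> places where moves happen,
  each place contributing at most \<open>p\<close> to the probability of leaving a word, so \<open>(card L + 2) * p = 1\<close>
  bounds the total by \<open>1\<close>. The comparison with the starred chain is then the sum of those at the left end,
  in the bulk and at the right end. The shift \<open>d\<close> is the number of stars that \<open>f\<close> attaches on the
  left.\<close>

lemma Omega_lumps_to_starred:
  assumes n0: "n0 \<le> n" and N: "3 \<le> N" and p: "0 \<le> p" "(real (card L) + 2) * p = 1"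
    and AB: "Omega_moves A" "Omega_moves B"
    and disjoint: "A \<inter> B = {}" "A \<inter> bulk L p = {}" "B \<inter> bulk L p = {}"
    and exit_le: "\<And>\<sigma>. move_sum A (\<lambda>_. 1) \<sigma> \<le> p" "\<And>\<sigma>. move_sum B (\<lambda>_. 1) \<sigma> \<le> p"
    and L: "L \<subseteq> {1..<n}" "(\<lambda>l. l + d) ` L = {2..N - 2}"
    and img: "f ` Omega n n0 = S"
    and left: "\<And>\<sigma> \<phi>. \<sigma> \<in> Omega n n0 \<Longrightarrow>
      move_sum (star_left a a' p) \<phi> (f \<sigma>) = move_sum A (\<phi> \<circ> f) \<sigma>"
    and right: "\<And>\<sigma> \<phi>. \<sigma> \<in> Omega n n0 \<Longrightarrow>
      move_sum (star_right (N - 1) b b' p) \<phi> (f \<sigma>) = move_sum B (\<phi> \<circ> f) \<sigma>"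
    and local: "\<And>r t. length r + 2 + length t = n \<Longrightarrow> length r + 1 \<in> L \<Longrightarrow>
      \<exists>r' t'. length r' = length r + d \<and> (\<forall>x y. f (r @ [x, y] @ t) = r' @ [x, y] @ t')"
  shows "lumps_via f (chain_of (Omega n n0) (A \<union> bulk L p \<union> B))
    (chain_of S (star_left a a' p \<union> bulk {2..N - 2} p \<union> star_right (N - 1) b b' p))"
proof -
  let ?R = "A \<union> bulk L p \<union> B"
  have finL: "finite L" using L(1) finite_subset by blast
  have R: "Omega_moves ?R"
    using AB by (intro Omega_moves_Un Omega_moves_TASEP p finL)
  have "finite A" "finite B" using AB by (simp_all add: Omega_moves_def proper_moves_def)
  then have split: "move_sum ?R \<phi> \<sigma> = move_sum A \<phi> \<sigma> + move_sum (bulk L p) \<phi> \<sigma> + move_sum B \<phi> \<sigma>" for \<phi> \<sigma>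
    using disjoint finL by (subst move_sum_Un, auto simp: finite_bulk move_sum_Un)
  have markov: "markov_chain (chain_of (Omega n n0) ?R)"
  proof (rule markov_chain_Omega[OF n0 R])
    show "move_sum ?R (\<lambda>_. 1) \<sigma> \<le> 1" for \<sigma>
      using exit_le[of \<sigma>] exit_bulk_le[OF p(1) finL, of \<sigma>] p(2)
      unfolding split by (simp add: algebra_simps)
  qed
  show ?thesis
  proof (rule lumps_via_if_intertwines[OF markov _ proper_moves_D_star _ img])
    show "proper_moves ?R" using R by (simp add: Omega_moves_def)
    show "overwrite l v \<sigma> \<in> Omega n n0"
      if "\<sigma> \<in> Omega n n0" "(l, u, v, q) \<in> ?R" "reads l u \<sigma>" for l u v q \<sigma>
      using overwrite_in_Omega[OF R that] .
    fix \<sigma> \<phi> assume \<sigma>: "\<sigma> \<in> Omega n n0"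
    then have len: "length \<sigma> = n" by (simp add: Omega_def)
    have "move_sum (bulk ((\<lambda>l. l + d) ` L) p) \<phi> (f \<sigma>) = move_sum (bulk L p) (\<phi> \<circ> f) \<sigma>"
    proof (rule bulk_intertwines[OF finL])
      fix l assume l: "l \<in> L"
      then have "1 \<le> l" "l < length \<sigma>" using L(1) len by auto
      then obtain r x y t where \<sigma>_eq: "\<sigma> = r @ [x, y] @ t" and r: "length r = l - 1"
        by (rule obtain_pair)
      have "length r + 2 + length t = n" "length r + 1 \<in> L"
        using len l \<open>1 \<le> l\<close> r by (simp_all add: \<sigma>_eq)
      from local[OF this] obtain r' t' where "length r' = length r + d"
        "\<forall>x y. f (r @ [x, y] @ t) = r' @ [x, y] @ t'" by blast
      then show "\<exists>r x y t r' t'. \<sigma> = r @ [x, y] @ t \<and> length r = l - 1 \<and>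
          length r' = l + d - 1 \<and> (\<forall>c e. f (r @ [c, e] @ t) = r' @ [c, e] @ t')"
        using \<sigma>_eq r \<open>1 \<le> l\<close>
        by (intro exI[of _ r] exI[of _ x] exI[of _ y] exI[of _ t] exI[of _ r'] exI[of _ t']) simp
    qed
    then show "move_sum (star_left a a' p \<union> bulk {2..N - 2} p \<union> star_right (N - 1) b b' p) \<phi> (f \<sigma>)
        = move_sum ?R (\<phi> \<circ> f) \<sigma>"
      unfolding split move_sum_D_star[OF N] by (simp only: left[OF \<sigma>] right[OF \<sigma>] L(2))
  qed
qed

section \<open>The lumpings onto words with stars\<close>

lemma word_ends:
  assumes "2 \<le> length \<sigma>"
  obtains x w y where "\<sigma> = x # w @ [y]"
  using assms by (cases \<sigma>; cases "tl \<sigma>" rule: rev_cases) auto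

lemma Omega_star_iff:
  "x # w @ [y] \<in> Omega_star (length w + 2) n0 \<longleftrightarrow>
     x \<in> {Zero, Star} \<and> y \<in> {Zero, Star} \<and> set w \<subseteq> {Neg, Zero, Pos} \<and>
     count_list (x # w @ [y]) Zero = n0"
  by (simp add: Omega_star_def sites_def)

text \<open>A section of \<^const>\<open>star\<close> over the letters \<open>0\<close> and \<open>*\<close>, used to find preimages under the lumping maps; the sign is arbitrary.\<close>

definition unstar :: "letter \<Rightarrow> letter" where
  "unstar x = (if x = Star then Pos else x)"

lemma star_unstar: "x \<in> {Zero, Star} \<Longrightarrow> star (unstar x) = x"
  by (auto simp: star_def unstar_def)

lemma star_in: "x \<in> {Neg, Zero, Pos} \<Longrightarrow> star x \<in> {Zero, Star}"
  by (auto simp: star_def)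

lemma star_Zero_iff [simp]: "star x = Zero \<longleftrightarrow> x = Zero"
  by (simp add: star_def)

lemma unstar_Zero_iff [simp]: "unstar x = Zero \<longleftrightarrow> x = Zero"
  by (simp add: unstar_def)

lemma unstar_in: "x \<in> {Zero, Star} \<Longrightarrow> unstar x \<in> {Neg, Zero, Pos}"
  by (auto simp: unstar_def)

lemma restrict_chain_of: "restrict_chain (chain_of S R) A = chain_of (S \<inter> A) R"
  by (simp add: restrict_chain_def chain_of_def)

lemma star_at_last: "length r = n - 1 \<Longrightarrow> star_at n (r @ [y]) = r @ [star y]"
  using star_at_append[of r n y "[]"] by simp


text \<open>The restricted chain only has the words with a star at both ends, so attaching stars is onto.
  The map is injective, so this lumping is in fact an isomorphism.\<close>

lemma C_check_lumps:
  assumes n: "1 \<le> n" "n0 \<le> n"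
  shows "lumps_via (\<lambda>w. Star # w @ [Star]) (C_check_TASEP n n0)
    (restrict_chain (D_star_TASEP (n + 2) n0 1 0 1 0) {\<sigma>. hd \<sigma> = Star \<and> last \<sigma> = Star})"
proof -
  let ?f = "\<lambda>w. Star # w @ [Star]"
  define p where "p = 1 / (real n + 1)"
  have "lumps_via ?f
     (chain_of (Omega n n0) ({(1, [Neg], [Pos], p)} \<union> bulk {1..n - 1} p \<union> {(n, [Pos], [Neg], p)}))
     (chain_of (Omega_star (n + 2) n0 \<inter> {\<sigma>. hd \<sigma> = Star \<and> last \<sigma> = Star})
       (star_left 1 0 p \<union> bulk {2..n + 2 - 2} p \<union> star_right (n + 2 - 1) 1 0 p))"
  proof (rule Omega_lumps_to_starred[where d = 1])
    show "0 \<le> p" "(real (card {1..n - 1}) + 2) * p = 1"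
      using n(1) by (simp_all add: p_def of_nat_diff)
    then show "Omega_moves {(1, [Neg], [Pos], p)}" "Omega_moves {(n, [Pos], [Neg], p)}"
      "\<And>\<sigma>. move_sum {(1, [Neg], [Pos], p)} (\<lambda>_. 1) \<sigma> \<le> p"
      "\<And>\<sigma>. move_sum {(n, [Pos], [Neg], p)} (\<lambda>_. 1) \<sigma> \<le> p"
      by (simp_all only: Omega_moves_TASEP exit_boundary_le)
    show "(\<lambda>l. l + 1) ` {1..n - 1} = {2..n + 2 - 2}"
      using n(1) image_add_atLeastAtMost[of 1 1 "n - 1"] by (simp add: add.commute numeral_2_eq_2)
    show "?f ` Omega n n0 = Omega_star (n + 2) n0 \<inter> {\<sigma>. hd \<sigma> = Star \<and> last \<sigma> = Star}"
    proof (intro equalityI subsetI)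
      fix \<tau> assume "\<tau> \<in> ?f ` Omega n n0"
      then show "\<tau> \<in> Omega_star (n + 2) n0 \<inter> {\<sigma>. hd \<sigma> = Star \<and> last \<sigma> = Star}"
        by (auto simp: Omega_def Omega_star_def sites_def)
    next
      fix \<tau> assume \<tau>: "\<tau> \<in> Omega_star (n + 2) n0 \<inter> {\<sigma>. hd \<sigma> = Star \<and> last \<sigma> = Star}"
      then obtain x w y where xwy: "\<tau> = x # w @ [y]"
        using word_ends[of \<tau>] by (auto simp: Omega_star_def)
      then have "w \<in> Omega n n0" "\<tau> = ?f w"
        using \<tau> by (auto simp: Omega_def Omega_star_def sites_def)
      then show "\<tau> \<in> ?f ` Omega n n0" by blast
    qed
    show "\<exists>r' t'. length r' = length r + 1 \<and> (\<forall>x y. ?f (r @ [x, y] @ t) = r' @ [x, y] @ t')" for r t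
      by (intro exI[of _ "Star # r"] exI[of _ "t @ [Star]"]) simp
    fix \<sigma> \<phi> assume "\<sigma> \<in> Omega n n0"
    then have len: "length \<sigma> = n" and "\<sigma> \<noteq> []" using n(1) by (auto simp: Omega_def)
    obtain x t where x: "\<sigma> = x # t" using \<open>\<sigma> \<noteq> []\<close> by (cases \<sigma>) auto
    show "move_sum (star_left 1 0 p) \<phi> (?f \<sigma>) = move_sum {(1, [Neg], [Pos], p)} (\<phi> \<circ> ?f) \<sigma>"
      unfolding x by (rule left_site_intertwines[where t' = "t @ [Star]"]) simp
    obtain r y where y: "\<sigma> = r @ [y]" using \<open>\<sigma> \<noteq> []\<close> by (cases \<sigma> rule: rev_cases) auto
    show "move_sum (star_right (n + 2 - 1) 1 0 p) \<phi> (?f \<sigma>) = move_sum {(n, [Pos], [Neg], p)} (\<phi> \<circ> ?f) \<sigma>"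
      unfolding y by (rule right_site_intertwines[where r' = "Star # r"]) (use len y in auto)
  qed (use n in \<open>auto simp: bulk_def\<close>)
  moreover have "p = 1 / (real (n + 2) - 1)" by (simp add: p_def)
  ultimately show ?thesis
    by (simp only: D_star_TASEP_eq restrict_chain_of C_check_TASEP_def Let_def p_def[symmetric])
qed

text \<open>The left end is as for the \<open>C\<close>-type chain, with an attached star and bonds shifted by \<open>1\<close>. The right end forgets
  the sign of the last letter; a bond in \<open>{1..n - 2}\<close> does not meet it.\<close>

lemma B_lumps:
  assumes n: "2 \<le> n" "n0 \<le> n"
  shows "lumps_via (\<lambda>w. Star # star_at n w) (B_TASEP n n0)
    (restrict_chain (D_star_TASEP (n + 1) n0 1 0 (1/2) (1/2)) {\<sigma>. hd \<sigma> = Star})"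
proof -
  let ?f = "\<lambda>w. Star # star_at n w"
  define p where "p = 1 / real n"
  have "lumps_via ?f
     (chain_of (Omega n n0) ({(1, [Neg], [Pos], p)} \<union> bulk {1..n - 2} p \<union> right_pair (n - 1) (p / 2)))
     (chain_of (Omega_star (n + 1) n0 \<inter> {\<sigma>. hd \<sigma> = Star})
       (star_left 1 0 p \<union> bulk {2..n + 1 - 2} p \<union> star_right (n + 1 - 1) (1/2) (1/2) p))"
  proof (rule Omega_lumps_to_starred[where d = 1])
    show "0 \<le> p" "(real (card {1..n - 2}) + 2) * p = 1"
      using n(1) by (simp_all add: p_def of_nat_diff)
    then show "Omega_moves {(1, [Neg], [Pos], p)}" "Omega_moves (right_pair (n - 1) (p / 2))"
      "\<And>\<sigma>. move_sum {(1, [Neg], [Pos], p)} (\<lambda>_. 1) \<sigma> \<le> p"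
      "\<And>\<sigma>. move_sum (right_pair (n - 1) (p / 2)) (\<lambda>_. 1) \<sigma> \<le> p"
      by (simp_all only: Omega_moves_TASEP exit_boundary_le)
    show "(\<lambda>l. l + 1) ` {1..n - 2} = {2..n + 1 - 2}"
      using n(1) image_add_atLeastAtMost[of 1 1 "n - 2"]
      by (simp add: add.commute numeral_2_eq_2 Suc_diff_Suc)
    show "?f ` Omega n n0 = Omega_star (n + 1) n0 \<inter> {\<sigma>. hd \<sigma> = Star}"
    proof (intro equalityI subsetI)
      fix \<tau> assume "\<tau> \<in> ?f ` Omega n n0"
      then obtain \<sigma> where \<sigma>: "\<sigma> \<in> Omega n n0" "\<tau> = ?f \<sigma>" by blast
      then have len: "length \<sigma> = n" by (simp add: Omega_def)
      then obtain x w y where xwy: "\<sigma> = x # w @ [y]" using n(1) word_ends[of \<sigma>] by auto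
      have "\<tau> = Star # (x # w) @ [star y]"
        using star_at_last[of "x # w" n y] len \<sigma>(2) xwy by simp
      moreover have "Star # (x # w) @ [star y] \<in> Omega_star (length (x # w) + 2) n0"
        using \<sigma>(1) xwy star_in[of y] unfolding Omega_star_iff by (auto simp: Omega_def)
      ultimately show "\<tau> \<in> Omega_star (n + 1) n0 \<inter> {\<sigma>. hd \<sigma> = Star}"
        using len xwy by simp
    next
      fix \<tau> assume \<tau>: "\<tau> \<in> Omega_star (n + 1) n0 \<inter> {\<sigma>. hd \<sigma> = Star}"
      then have "2 \<le> length \<tau>" using n(1) by (simp add: Omega_star_def)
      then obtain x w y where xwy: "\<tau> = x # w @ [y]" by (rule word_ends)
      have len: "n + 1 = length w + 2" and x: "x = Star" using \<tau> xwy by (auto simp: Omega_star_def)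
      have "Star # w @ [y] \<in> Omega_star (length w + 2) n0" using \<tau> unfolding len xwy x by simp
      then have w: "y \<in> {Zero, Star}" "set w \<subseteq> {Neg, Zero, Pos}" "count_list (Star # w @ [y]) Zero = n0"
        unfolding Omega_star_iff by auto
      then have "w @ [unstar y] \<in> Omega n n0"
        using len unstar_in[OF w(1)] by (auto simp: Omega_def)
      moreover have "?f (w @ [unstar y]) = \<tau>"
        using star_at_last[of w n "unstar y"] len star_unstar[OF w(1)] x xwy by simp
      ultimately show "\<tau> \<in> ?f ` Omega n n0" by blast
    qed
    show "\<exists>r' t'. length r' = length r + 1 \<and> (\<forall>x y. ?f (r @ [x, y] @ t) = r' @ [x, y] @ t')"
      if "length r + 2 + length t = n" "length r + 1 \<in> {1..n - 2}" for r t
    proof -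
      have "t \<noteq> []" using that by auto
      then obtain t1 z where "t = t1 @ [z]" by (cases t rule: rev_cases) auto
      then show ?thesis using that(1) star_at_last[of "r @ [_, _] @ t1" n z]
        by (intro exI[of _ "Star # r"] exI[of _ "t1 @ [star z]"]) simp
    qed
    fix \<sigma> \<phi> assume \<sigma>: "\<sigma> \<in> Omega n n0"
    then have len: "length \<sigma> = n" by (simp add: Omega_def)
    then obtain x w y where x: "\<sigma> = x # w @ [y]" using n(1) word_ends[of \<sigma>] by auto
    have f: "?f (c # w @ [e]) = Star # c # w @ [star e]" for c e
      using star_at_last[of "c # w" n e] len x by simp
    show "move_sum (star_left 1 0 p) \<phi> (?f \<sigma>) = move_sum {(1, [Neg], [Pos], p)} (\<phi> \<circ> ?f) \<sigma>"
      unfolding x by (rule left_site_intertwines[where t' = "w @ [star y]"]) (rule f)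
    obtain r z where z: "x # w = r @ [z]" by (cases "x # w" rule: rev_cases) auto
    have \<sigma>_eq: "\<sigma> = r @ [z, y]" using x z by (metis Cons_eq_appendI append.assoc append_Cons append_Nil)
    have f: "?f (r @ [c, e]) = (Star # r) @ [c, star e]" for c e
      using star_at_last[of "r @ [c]" n e] len \<sigma>_eq by simp
    show "move_sum (star_right (n + 1 - 1) (1/2) (1/2) p) \<phi> (?f \<sigma>)
        = move_sum (right_pair (n - 1) (p / 2)) (\<phi> \<circ> ?f) \<sigma>"
      unfolding \<sigma>_eq
      by (rule right_pair_intertwines[OF f]) (use len \<sigma> \<sigma>_eq in \<open>auto simp: Omega_def\<close>)
  qed (use n in \<open>auto simp: bulk_def right_pair_def\<close>)
  moreover have "p = 1 / (real (n + 1) - 1)" by (simp add: p_def)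
  ultimately show ?thesis
    by (simp only: D_star_TASEP_eq restrict_chain_of B_TASEP_def Let_def p_def[symmetric])
qed

text \<open>Both ends forget a sign. As \<open>n \<ge> 3\<close>, the second site is not the last one, so that the moves at
  one end do not see the sign forgotten at the other.\<close>

lemma D_lumps:
  assumes n: "3 \<le> n" "n0 \<le> n"
  shows "lumps_via (star_at 1 \<circ> star_at n) (D_TASEP n n0)
    (D_star_TASEP n n0 (1/2) (1/2) (1/2) (1/2))"
proof -
  let ?f = "star_at 1 \<circ> star_at n"
  define p where "p = 1 / (real n - 1)"
  have f: "?f (x # w @ [y]) = star x # w @ [star y]" if "length w + 2 = n" for x w y
    using star_at_last[of "x # w" n y] star_at_append[of "[]" 1 x "w @ [star y]"] that by simp
  have "lumps_via ?f
     (chain_of (Omega n n0) (left_pair (p / 2) \<union> bulk {2..n - 2} p \<union> right_pair (n - 1) (p / 2)))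
     (chain_of (Omega_star n n0)
       (star_left (1/2) (1/2) p \<union> bulk {2..n - 2} p \<union> star_right (n - 1) (1/2) (1/2) p))"
  proof (rule Omega_lumps_to_starred[where d = 0])
    show "0 \<le> p" "(real (card {2..n - 2}) + 2) * p = 1"
      using n(1) by (simp_all add: p_def of_nat_diff)
    then show "Omega_moves (left_pair (p / 2))" "Omega_moves (right_pair (n - 1) (p / 2))"
      "\<And>\<sigma>. move_sum (left_pair (p / 2)) (\<lambda>_. 1) \<sigma> \<le> p"
      "\<And>\<sigma>. move_sum (right_pair (n - 1) (p / 2)) (\<lambda>_. 1) \<sigma> \<le> p"
      by (simp_all only: Omega_moves_TASEP exit_boundary_le)
    show "?f ` Omega n n0 = Omega_star n n0"
    proof (intro equalityI subsetI)
      fix \<tau> assume "\<tau> \<in> ?f ` Omega n n0"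
      then obtain \<sigma> where \<sigma>: "\<sigma> \<in> Omega n n0" "\<tau> = ?f \<sigma>" by blast
      then have len: "length \<sigma> = n" by (simp add: Omega_def)
      then obtain x w y where xwy: "\<sigma> = x # w @ [y]" using n(1) word_ends[of \<sigma>] by auto
      then have n_eq: "n = length w + 2" using len by simp
      have "\<tau> = star x # w @ [star y]" using f[of w x y] n_eq \<sigma>(2) xwy by simp
      moreover have "star x # w @ [star y] \<in> Omega_star (length w + 2) n0"
        using \<sigma>(1) xwy star_in[of x] star_in[of y] unfolding Omega_star_iff by (auto simp: Omega_def)
      ultimately show "\<tau> \<in> Omega_star n n0" using n_eq by simp
    next
      fix \<tau> assume \<tau>: "\<tau> \<in> Omega_star n n0"
      then have "2 \<le> length \<tau>" using n(1) by (simp add: Omega_star_def)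
      then obtain x w y where xwy: "\<tau> = x # w @ [y]" by (rule word_ends)
      have len: "n = length w + 2" using \<tau> xwy by (auto simp: Omega_star_def)
      have w: "x \<in> {Zero, Star}" "y \<in> {Zero, Star}" "set w \<subseteq> {Neg, Zero, Pos}"
        "count_list (x # w @ [y]) Zero = n0"
        using \<tau> unfolding len xwy Omega_star_iff by auto
      then have "unstar x # w @ [unstar y] \<in> Omega n n0"
        using len unstar_in[OF w(1)] unstar_in[OF w(2)] by (auto simp: Omega_def)
      moreover have "?f (unstar x # w @ [unstar y]) = \<tau>"
        using f[of w] len star_unstar[OF w(1)] star_unstar[OF w(2)] xwy by simp
      ultimately show "\<tau> \<in> ?f ` Omega n n0" by blast
    qed
    show "\<exists>r' t'. length r' = length r + 0 \<and> (\<forall>x y. ?f (r @ [x, y] @ t) = r' @ [x, y] @ t')"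
      if "length r + 2 + length t = n" "length r + 1 \<in> {2..n - 2}" for r t
    proof -
      have "t \<noteq> []" "r \<noteq> []" using that by auto
      then obtain t1 z a r1 where "t = t1 @ [z]" "r = a # r1"
        by (cases t rule: rev_cases; cases r) auto
      then show ?thesis using that(1) f[of "r1 @ [_, _] @ t1" a z]
        by (intro exI[of _ "star a # r1"] exI[of _ "t1 @ [star z]"]) simp
    qed
    fix \<sigma> \<phi> assume \<sigma>: "\<sigma> \<in> Omega n n0"
    then have len: "length \<sigma> = n" and letters: "Star \<notin> set \<sigma>" by (auto simp: Omega_def)
    then obtain x w y where x: "\<sigma> = x # w @ [y]" using n(1) word_ends[of \<sigma>] by auto
    have "w \<noteq> []" using len x n(1) by auto
    then obtain c w1 where w1: "w = c # w1" by (cases w) auto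
    show "move_sum (star_left (1/2) (1/2) p) \<phi> (?f \<sigma>) = move_sum (left_pair (p / 2)) (\<phi> \<circ> ?f) \<sigma>"
      unfolding x w1 append_Cons
    proof (rule left_pair_intertwines)
      show "?f (a # b # w1 @ [y]) = star a # b # w1 @ [star y]" for a b
        using f[of "b # w1" a y] len x w1 by simp
    qed (use letters x w1 in auto)
    obtain r z where z: "w = r @ [z]" using \<open>w \<noteq> []\<close> by (cases w rule: rev_cases) auto
    have \<sigma>_eq: "\<sigma> = (x # r) @ [z, y]" using x z by simp
    show "move_sum (star_right (n - 1) (1/2) (1/2) p) \<phi> (?f \<sigma>)
        = move_sum (right_pair (n - 1) (p / 2)) (\<phi> \<circ> ?f) \<sigma>"
      unfolding \<sigma>_eq
    proof (rule right_pair_intertwines)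
      show "?f ((x # r) @ [a, b]) = (star x # r) @ [a, star b]" for a b
        using f[of "r @ [a]" x b] len x z by simp
    qed (use len letters \<sigma>_eq in auto)
  qed (use n in \<open>auto simp: bulk_def boundary_defs\<close>)
  then show ?thesis
    by (simp only: D_star_TASEP_eq[OF p_def] D_TASEP_def Let_def p_def[symmetric])
qed


section \<open>Passing to the marginal processes\<close>

lemma marginal_if_lumps_via:
  assumes fX: "lumps_via f C X" and inj: "inj_on g (states X)"
    and h: "\<And>\<sigma>. \<sigma> \<in> states C \<Longrightarrow> g (f \<sigma>) = h \<sigma>"
  shows "lumps_via g X (marginal_chain g X)" "lumps_via h C (marginal_chain g X)"
proof -
  show gX: "lumps_via g X (marginal_chain g X)"
    using fX inj by (intro lumps_via_marginal) (simp_all add: lumps_via_def)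
  show "lumps_via h C (marginal_chain g X)"
    using lumps_via_cong[OF lumps_via_comp[OF fX gX]] h by simp
qed

theorem theorem5p5:
  shows "(\<forall>n n0 :: nat. 1 \<le> n \<and> n0 \<le> n \<longrightarrow>
           (let X = restrict_chain (D_star_TASEP (n + 2) n0 1 0 1 0)
                      {\<sigma>. hd \<sigma> = Star \<and> last \<sigma> = Star};
                M = marginal_chain (sites 2 (n + 1)) X
            in lumps_via (sites 2 (n + 1)) X M \<and> isomorphic_chains M (C_check_TASEP n n0)))
       \<and> (\<forall>n n0 :: nat. 2 \<le> n \<and> n0 \<le> n \<longrightarrow>
           (let X = restrict_chain (D_star_TASEP (n + 1) n0 1 0 (1/2) (1/2)) {\<sigma>. hd \<sigma> = Star};
                M = marginal_chain (sites 2 (n + 1)) X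
            in lumps_via (sites 2 (n + 1)) X M \<and> lumps_via (star_at n) (B_TASEP n n0) M))
       \<and> (\<forall>n n0 :: nat. 3 \<le> n \<and> n0 \<le> n \<longrightarrow>
           lumps_via (star_at 1 \<circ> star_at n) (D_TASEP n n0)
             (D_star_TASEP n n0 (1/2) (1/2) (1/2) (1/2)))"
proof (intro conjI allI impI)
  fix n n0 :: nat assume n: "1 \<le> n \<and> n0 \<le> n"
  define X where "X = restrict_chain (D_star_TASEP (n + 2) n0 1 0 1 0) {\<sigma>. hd \<sigma> = Star \<and> last \<sigma> = Star}"
  have lump: "lumps_via (\<lambda>w. Star # w @ [Star]) (C_check_TASEP n n0) X"
    unfolding X_def using n by (intro C_check_lumps) auto
  have Omega: "states (C_check_TASEP n n0) = Omega n n0" by (simp add: C_check_TASEP_def Let_def)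
  have X: "states X = (\<lambda>w. Star # w @ [Star]) ` Omega n n0"
    using lump Omega by (simp add: lumps_via_def)
  have sites: "sites 2 (n + 1) (Star # w @ [Star]) = w" if "w \<in> Omega n n0" for w
    using that by (simp add: sites_def Omega_def)
  have "inj_on (sites 2 (n + 1)) (states X)"
    unfolding X by (intro inj_onI) (use sites in auto)
  \<comment> \<open>Attaching the two stars and then reading the interior gives back the word.\<close>
  note marginal = marginal_if_lumps_via[OF lump this, where h = "\<lambda>w. w", unfolded Omega, OF sites]
  show "let X = restrict_chain (D_star_TASEP (n + 2) n0 1 0 1 0) {\<sigma>. hd \<sigma> = Star \<and> last \<sigma> = Star};
            M = marginal_chain (sites 2 (n + 1)) X
        in lumps_via (sites 2 (n + 1)) X M \<and> isomorphic_chains M (C_check_TASEP n n0)"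
    unfolding Let_def X_def[symmetric]
    using marginal isomorphic_chains_if_lumps_via_id by blast
next
  fix n n0 :: nat assume n: "2 \<le> n \<and> n0 \<le> n"
  define X where "X = restrict_chain (D_star_TASEP (n + 1) n0 1 0 (1/2) (1/2)) {\<sigma>. hd \<sigma> = Star}"
  have lump: "lumps_via (\<lambda>w. Star # star_at n w) (B_TASEP n n0) X"
    unfolding X_def using n by (intro B_lumps) auto
  have Omega: "states (B_TASEP n n0) = Omega n n0" by (simp add: B_TASEP_def Let_def)
  have X: "states X = (\<lambda>w. Star # star_at n w) ` Omega n n0"
    using lump Omega by (simp add: lumps_via_def)
  have sites: "sites 2 (n + 1) (Star # star_at n w) = star_at n w" if "w \<in> Omega n n0" for w
    using that by (simp add: sites_def Omega_def star_at_def)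
  have "inj_on (sites 2 (n + 1)) (states X)"
    unfolding X by (intro inj_onI) (use sites in auto)
  note marginal = marginal_if_lumps_via[OF lump this, where h = "star_at n", unfolded Omega, OF sites]
  show "let X = restrict_chain (D_star_TASEP (n + 1) n0 1 0 (1/2) (1/2)) {\<sigma>. hd \<sigma> = Star};
            M = marginal_chain (sites 2 (n + 1)) X
        in lumps_via (sites 2 (n + 1)) X M \<and> lumps_via (star_at n) (B_TASEP n n0) M"
    unfolding Let_def X_def[symmetric] using marginal by blast
next
  fix n n0 :: nat assume "3 \<le> n \<and> n0 \<le> n"
  then show "lumps_via (star_at 1 \<circ> star_at n) (D_TASEP n n0)
      (D_star_TASEP n n0 (1/2) (1/2) (1/2) (1/2))"
    by (intro D_lumps) auto
qed

end
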